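(* Let $P,Q$ be real numbers with $P>0$, $Q\neq 0$, and $Q\le P-1$ if $P>2$, $Q<P-1$ if $0<P\le 2$. Let $a\ge b$ be the roots of $x^2-Px+Q=0$, $D=P^2-4Q=(a-b)^2$, let $U_n=\frac{a^n-b^n}{a-b}$ for $n\ge 1$ and, by definition, $U_0=1$, and let $\zeta_U(s,z)=\sum_{n=0}^\infty (z+U_n)^{-s}$ be the associated Hurwitz-type zeta function. Let $l_{Q,k}$, $A_{a,b}(k)$, $B(a,b)$ and $\tilde d_{a,b}(j)$ be as defined in the context. For $z\in\mathbb{C}\setminus(-\infty,0]$ the Hurwitz-type zeta function $\zeta_U(s,z)$ can be continued to a meromorphic function on the complex $s$-plane, with simple poles at $$s=-\ell\qquad\text{and}\qquad s_{\ell,k,n}=-\ell-k\left(1-\frac{\log|b|}{\log a}\right)+\frac{(2n+l_{Q,k})\pi i}{\log a},\qquad \ell,k\in\mathbb{N}_0,\ n\in A_{a,b}(k),$$ with the corresponding residues given by $$\frac{z^{\ell}}{\log a}+\sum_{j\in B(a,b),\ j\le \ell}\tilde d_{a,b}(j)\,(-\ell)_j\,z^{\ell-j}$$ and $$C_{a,b}(k)\,D^{\frac{n\pi i}{\log a}}\,\frac{(-z)^{\ell}}{\ell!}\prod_{j=1}^{\ell+k}\left(k\frac{\log|b|}{\log a}+\frac{(2n+l_{Q,k})\pi i}{\log a}-j\right),$$ respectively, where $$C_{a,b}(k)=\frac{1}{k!\log a}\,D^{\frac{k}{2}\left(\frac{\log|b|}{\log a}-1\right)+\frac{l_{Q,k}\pi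 i}{2\log a}},$$ with the convention that if $s_{\ell_1,k_1,n_1}=s_{\ell_2,k_2,n_2}$ for different triples $(\ell_m,k_m,n_m)$, $m=1,2$, the corresponding residues are added.
   Context: $\mathbb{N}=\{1,2,\dots\}$, $\mathbb{N}_0=\mathbb{N}\cup\{0\}$. Under the stated assumptions on $P,Q$ one has $a,b\in\mathbb R$, $a>1$, $a>|b|>0$, $D>0$, $Q=ab$, and $U_n>0$ for $n\ge1$. The Hurwitz-type zeta function $\zeta_U(s,z)=\sum_{n=0}^\infty (z+U_n)^{-s}$ is initially defined for $\Re(s)>0$ and $\Re(z)>0$, with powers given by the principal branch of the logarithm. For positive real $D$ and complex $w$, $D^w=e^{w\log D}$. $(x)_j=x(x+1)\cdots(x+j-1)$ is the Pochhammer symbol, $(x)_0=1$. $l_{Q,k}=k$ if $Q<0$, and $l_{Q,k}=0$ if $Q>0$. For $k\in\mathbb{N}_0$: - $A_{a,b}(k)=\mathbb{Z}$ if $\frac{\log|b|}{\log a}k\notin\mathbb{Z}_{\le0}$ or ($Q<0$ and $k$ is odd); - $A_{a,b}(k)=\mathbb{Z}\setminus\{0\}$ if $\frac{\log|b|}{\log a}k\in\mathbb{Z}_{\le 0}$ and $Q>0$; - $A_{a,b}(k)=\mathbb{Z}\setminus\{-k/2\}$ if $\frac{\log|b|}{\log a}k\in\mathbb{Z}_{\le 0}$, $Q<0$ and $k$ is even. $B(a,b)$ is the set of all $\ell\in\mathbb{N}$ for which there is $k\in\mathbb{N}$ with $\ell=k\left(1-\frac{\log|b|}{\log a}\right)$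 and $\frac{\log|b|}{\log a}k\in\mathbb{Z}_{\le0}$, where moreover $k$ is required to be even if $Q<0$. (Such $k$ is uniquely determined by $\ell$; $B(a,b)$ may be empty.) For $\ell\in B(a,b)$, with $k\in\mathbb{N}$ the integer such that $\ell=k\left(1-\frac{\log|b|}{\log a}\right)$, $$\tilde d_{a,b}(\ell)=\frac{(-1)^{\ell+k}}{\ell!}\,D^{-\ell/2}\,\frac{1}{\log a}\binom{\ell}{k}.$$
   Formalization: Listed points are shown to be simple poles exactly when their total residue is nonzero; the literal claim that all are poles fails, e.g. for Q=1, ℓ=2, z=√(2/D), where the residue at s=-2 vanishes. *)

theory Defs
  imports "HOL-Complex_Analysis.Complex_Analysis"
begin

definition lucas_U :: "real \<Rightarrow> real \<Rightarrow> nat \<Rightarrow> real" where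
  "lucas_U a b n = (if n = 0 then 1 else (a ^ n - b ^ n) / (a - b))"

definition zeta_U :: "real \<Rightarrow> real \<Rightarrow> complex \<Rightarrow> complex \<Rightarrow> complex" where
  "zeta_U a b s z = (\<Sum>n. (z + of_real (lucas_U a b n)) powr (- s))"

definition log_ratio :: "real \<Rightarrow> real \<Rightarrow> real" where
  "log_ratio a b = ln \<bar>b\<bar> / ln a"

definition l_index :: "real \<Rightarrow> nat \<Rightarrow> nat" where
  "l_index Q k = (if Q < 0 then k else 0)"

definition A_set :: "real \<Rightarrow> real \<Rightarrow> real \<Rightarrow> nat \<Rightarrow> int set" where
  "A_set Q a b k =
     (if log_ratio a b * real k \<notin> \<int>\<^sub>\<le>\<^sub>0 \<or> (Q < 0 \<and> odd k) then UNIV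
      else if Q > 0 then UNIV - {0}
      else UNIV - {- int (k div 2)})"

definition B_set :: "real \<Rightarrow> real \<Rightarrow> real \<Rightarrow> nat set" where
  "B_set Q a b =
     {l. l \<ge> 1 \<and> (\<exists>k\<ge>1. real l = real k * (1 - log_ratio a b) \<and>
                        log_ratio a b * real k \<in> \<int>\<^sub>\<le>\<^sub>0 \<and> (Q < 0 \<longrightarrow> even k))}"

definition d_tilde :: "real \<Rightarrow> real \<Rightarrow> real \<Rightarrow> nat \<Rightarrow> real" where
  "d_tilde D a b l =
     (let k = (THE k::nat. k \<ge> 1 \<and> real l = real k * (1 - log_ratio a b))
      in (- 1) ^ (l + k) / fact l * D powr (- real l / 2) * (1 / ln a) * real (l choose k))"

definition C_coeff :: "real \<Rightarrow> real \<Rightarrow> real \<Rightarrow> real \<Rightarrow> nat \<Rightarrow> complex" where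
  "C_coeff Q D a b k =
     1 / (fact k * of_real (ln a)) *
     of_real D powr (of_real (real k / 2 * (log_ratio a b - 1)) +
                     of_nat (l_index Q k) * of_real pi * \<i> / (2 * of_real (ln a)))"

definition imag_shift :: "real \<Rightarrow> real \<Rightarrow> nat \<Rightarrow> int \<Rightarrow> complex" where
  "imag_shift Q a k n =
     (2 * of_int n + of_nat (l_index Q k)) * of_real pi * \<i> / of_real (ln a)"

definition pole_lkn :: "real \<Rightarrow> real \<Rightarrow> real \<Rightarrow> nat \<Rightarrow> nat \<Rightarrow> int \<Rightarrow> complex" where
  "pole_lkn Q a b l k n =
     - of_nat l - of_real (real k * (1 - log_ratio a b)) + imag_shift Q a k n"

definition res_int :: "real \<Rightarrow> real \<Rightarrow> real \<Rightarrow> real \<Rightarrow> complex \<Rightarrow> nat \<Rightarrow> complex" where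
  "res_int Q D a b z l =
     z ^ l / of_real (ln a) +
     (\<Sum>j \<in> {j \<in> B_set Q a b. j \<le> l}.
        of_real (d_tilde D a b j) * pochhammer (- of_nat l) j * z ^ (l - j))"

definition res_lkn ::
  "real \<Rightarrow> real \<Rightarrow> real \<Rightarrow> real \<Rightarrow> complex \<Rightarrow> nat \<Rightarrow> nat \<Rightarrow> int \<Rightarrow> complex" where
  "res_lkn Q D a b z l k n =
     C_coeff Q D a b k * of_real D powr (of_int n * of_real pi * \<i> / of_real (ln a)) *
     ((- z) ^ l / fact l) *
     (\<Prod>j = 1..l + k. of_real (real k * log_ratio a b) + imag_shift Q a k n - of_nat j)"

definition triples_at :: "real \<Rightarrow> real \<Rightarrow> real \<Rightarrow> complex \<Rightarrow> (nat \<times> nat \<times> int) set" where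
  "triples_at Q a b p = {(l, k, n). n \<in> A_set Q a b k \<and> pole_lkn Q a b l k n = p}"

text \<open>The sums over \<^const>\<open>triples_at\<close> are finite sums:\<close>

lemma finite_triples_at:
  assumes "a > 1" "a > \<bar>b\<bar>" "b \<noteq> 0"
  shows "finite (triples_at Q a b p)"
proof -
  have lna: "ln a > 0" using assms by simp
  define c where "c = 1 - log_ratio a b"
  have "ln \<bar>b\<bar> < ln a" using assms by (subst ln_less_cancel_iff) auto
  hence c: "c > 0" using lna by (simp add: c_def log_ratio_def field_simps)
  have re: "Re (pole_lkn Q a b l k n) = - real l - real k * c" for l k n
    by (simp add: pole_lkn_def imag_shift_def c_def Re_divide_of_real)
  have im: "Im (pole_lkn Q a b l k n) =
              (2 * real_of_int n + real (l_index Q k)) * pi / ln a" for l k n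
    by (simp add: pole_lkn_def imag_shift_def Im_divide_of_real)
  let ?f = "\<lambda>(l, k, n::int). (l::nat, k::nat)"
  let ?N = "nat \<lceil>- Re p\<rceil>" and ?M = "nat \<lceil>- Re p / c\<rceil>"
  have "inj_on ?f (triples_at Q a b p)"
  proof (rule inj_onI, clarsimp simp: triples_at_def)
    fix l k n m
    assume "pole_lkn Q a b l k m = pole_lkn Q a b l k n"
    hence "Im (pole_lkn Q a b l k m) = Im (pole_lkn Q a b l k n)" by simp
    thus "n = m" unfolding im using lna by simp
  qed
  moreover have "?f ` triples_at Q a b p \<subseteq> {..?N} \<times> {..?M}"
  proof (clarsimp simp: triples_at_def, intro conjI)
    fix l k n
    have "real k * c \<ge> 0" using c by simp
    thus "l \<le> nat \<lceil>- Re (pole_lkn Q a b l k n)\<rceil>" unfolding re by linarith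
    have "real k \<le> - Re (pole_lkn Q a b l k n) / c"
      unfolding re using c by (simp add: field_simps)
    thus "k \<le> nat \<lceil>- (Re (pole_lkn Q a b l k n) / c)\<rceil>" by (simp, linarith)
  qed
  ultimately show ?thesis
    using finite_subset[of _ "{..?N} \<times> {..?M}"] by (metis finite_SigmaI finite_atMost finite_imageD)
qed

end

theory Submission
  imports Defs
begin

text \<open>
  For large \<open>n\<close> write \<open>z + U\<^sub>n = a\<^sup>n / (a - b) * (1 - x\<^sub>n)\<close> with \<open>x\<^sub>n = (b / a)\<^sup>n - z (a - b) a\<^sup>-\<^sup>n\<close>. Expanding
  \<open>(1 - x\<^sub>n)\<close> to the power \<open>- s\<close> by the binomial series, expanding the powers of \<open>x\<^sub>n\<close>, and summing over
  \<open>n\<close> first turns the tail of the zeta function into a double series over \<open>(l, k)\<close> of entire functions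
  times \<open>q\<^sup>N / (1 - q)\<close>, where \<open>q = a powr (- s - l - k) * b ^ k\<close> is the ratio of a geometric series.
  On a bounded set of \<open>s\<close> only finitely many of the denominators \<open>1 - q\<close> can vanish, and the rest of the
  double series converges uniformly, which gives the continuation. All pairs \<open>(l, k)\<close> with \<open>q = 1\<close> at a
  point \<open>p\<close> have the same function \<open>q\<close>, namely \<open>a powr (p - s)\<close>, so every pole is simple and the residues
  add up. The triples excluded by \<open>A\<close> are those that contribute nonzero residues at nonpositive integers.
\<close>

section \<open>Interchange of summation, simple poles, binomial majorants\<close>

text \<open>The product bound makes the family absolutely summable over all pairs, so Fubini
  applies. Unordered sums are used only inside: both series in the application are sequential, with
  \<open>A\<close> geometric in the index of the zeta series and \<open>B\<close> a binomial
  majorant in the degree of the expansion.\<close>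

lemma sums_swap_of_product_bound:
  fixes f :: "nat \<Rightarrow> nat \<Rightarrow> complex" and A B :: "nat \<Rightarrow> real"
  assumes bound: "\<And>n m. norm (f n m) \<le> A n * B m"
    and A: "summable A" "\<And>n. A n \<ge> 0" and B: "summable B" "\<And>m. B m \<ge> 0"
    and row: "\<And>n. (\<lambda>m. f n m) sums g n" and col: "\<And>m. (\<lambda>n. f n m) sums h m"
  shows "g sums suminf h"
proof -
  have A': "A summable_on UNIV" and B': "B summable_on UNIV"
    using A B by (simp_all add: summable_on_UNIV_nonneg_real_iff)
  have "(\<lambda>x. norm ((\<lambda>(n, m). A n * B m) x)) summable_on UNIV \<times> UNIV"
    unfolding Infinite_Sum.abs_summable_on_Sigma_iff
  proof (intro conjI ballI)
    show "(\<lambda>m. norm (case (n, m) of (n, m) \<Rightarrow> A n * B m)) summable_on UNIV" for n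
      using summable_on_cmult_right[OF B', of "A n"] A B by (simp add: abs_mult)
    have "(\<lambda>n. A n * infsum B UNIV) summable_on UNIV"
      using summable_on_cmult_left[OF A'] by simp
    then show "(\<lambda>n. norm (\<Sum>\<^sub>\<infinity>m. norm (case (n, m) of (n, m) \<Rightarrow> A n * B m))) summable_on UNIV"
      using A B by (simp add: abs_mult infsum_cmult_right' infsum_nonneg)
  qed
  then have "(\<lambda>x. norm ((\<lambda>(n, m). f n m) x)) summable_on UNIV \<times> UNIV"
    by (rule Infinite_Sum.abs_summable_on_comparison_test) (use bound A B in \<open>auto simp: abs_mult\<close>)
  then have summ: "(\<lambda>(n, m). f n m) summable_on UNIV \<times> UNIV"
    by (rule abs_summable_summable)
  then have summ': "(\<lambda>(m, n). f n m) summable_on UNIV \<times> UNIV"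
    using summable_on_swap[of "\<lambda>(n, m). f n m" UNIV UNIV] by (simp add: case_prod_unfold)
  have row': "infsum (f n) UNIV = g n" for n
  proof -
    have "summable (\<lambda>m. norm (f n m))"
      by (rule summable_comparison_test'[where g = "\<lambda>m. A n * B m" and N = 0])
         (use bound summable_mult[OF B(1)] in auto)
    then show ?thesis using norm_summable_imp_has_sum[OF _ row] by (simp add: infsumI)
  qed
  have col': "infsum (\<lambda>n. f n m) UNIV = h m" for m
  proof -
    have "summable (\<lambda>n. norm (f n m))"
      by (rule summable_comparison_test'[where g = "\<lambda>n. A n * B m" and N = 0])
         (use bound summable_mult2[OF A(1)] in auto)
    then show ?thesis using norm_summable_imp_has_sum[OF _ col] by (simp add: infsumI)
  qed
  have g: "g summable_on UNIV" using summable_on_Sigma_banach[OF summ] row' by simp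
  have h: "h summable_on UNIV" using summable_on_Sigma_banach[OF summ'] col' by simp
  have "infsum g UNIV = infsum h UNIV"
    using infsum_swap_banach[OF summ] row' col' by simp
  moreover have "suminf h = infsum h UNIV"
    using h by (metis has_sum_imp_sums has_sum_infsum sums_unique)
  ultimately show "g sums suminf h"
    using g by (metis has_sum_imp_sums has_sum_infsum)
qed

text \<open>The numerator \<open>\<phi>\<close> may vanish at \<open>p\<close>; its difference
  quotient then extends analytically and no pole is left. This case has to be covered because the
  contributions of several pairs \<open>(l, k)\<close> to one point may cancel.\<close>

lemma
  assumes phi: "\<phi> analytic_on {p}" and psi: "\<psi> analytic_on {p}"
    and eq: "\<forall>\<^sub>F s in at p. f s = \<phi> s / (s - p) + \<psi> s"
  shows residue_simple_pole_form: "residue f p = \<phi> p"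
    and is_pole_simple_pole_form_iff: "is_pole f p \<longleftrightarrow> \<phi> p \<noteq> 0"
    and zorder_simple_pole_form: "is_pole f p \<Longrightarrow> zorder f p = -1"
    and meromorphic_simple_pole_form: "f meromorphic_on {p}"
proof -
  define g where "g = (\<lambda>s. \<phi> s / (s - p) + \<psi> s)"
  have eq': "\<forall>\<^sub>F s in at p. f s = g s" using eq by (simp add: g_def)
  obtain A where A: "open A" "p \<in> A" "\<phi> holomorphic_on A" using phi unfolding analytic_at by blast
  obtain B where B: "open B" "p \<in> B" "\<psi> holomorphic_on B" using psi unfolding analytic_at by blast
  define S where "S = A \<inter> B"
  have S: "open S" "p \<in> S" "\<phi> holomorphic_on S" "\<psi> holomorphic_on S"
    using A B unfolding S_def by (auto intro: holomorphic_on_subset)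
  have "residue g p = residue (\<lambda>s. \<phi> s / (s - p)) p + residue \<psi> p"
    unfolding g_def
    by (rule residue_add[OF S(1,2)])
       (use S in \<open>auto intro!: holomorphic_intros intro: holomorphic_on_subset\<close>)
  also have "\<dots> = \<phi> p" using residue_simple[OF S(1-3)] residue_holo[OF S(1,2,4)] by simp
  finally show "residue f p = \<phi> p" using residue_cong[OF eq' refl] by simp
  have lim: "(\<phi> \<longlongrightarrow> \<phi> p) (at p)" "(\<psi> \<longlongrightarrow> \<psi> p) (at p)"
    using phi psi by (simp_all add: analytic_at_imp_isCont isContD)
  have pole: "is_pole g p" if "\<phi> p \<noteq> 0"
  proof -
    have "is_pole (\<lambda>s. \<phi> s / (s - p)) p"
      by (rule is_pole_divide)
         (use that phi in \<open>auto simp: analytic_at_imp_isCont filterlim_at eventually_at_filter intro!: tendsto_eq_intros\<close>)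
    then show ?thesis
      unfolding g_def is_pole_def using lim(2) tendsto_add_filterlim_at_infinity' by blast
  qed
  have npole: "\<not> is_pole g p" if "\<phi> p = 0"
  proof -
    define d where "d = (\<lambda>s. if s = p then deriv \<phi> p else (\<phi> s - \<phi> p) / (s - p))"
    have "d holomorphic_on S" unfolding d_def using S by (intro pole_lemma_open)
    then have "(\<lambda>s. d s + \<psi> s) holomorphic_on S" using S by (intro holomorphic_intros)
    then have "\<not> is_pole (\<lambda>s. d s + \<psi> s) p" using S not_is_pole_holomorphic by blast
    moreover have "\<forall>\<^sub>F s in at p. g s = d s + \<psi> s"
      unfolding eventually_at_filter by (auto simp: g_def d_def that intro!: always_eventually)
    ultimately show ?thesis using is_pole_cong[OF _ refl] by metis
  qed
  show iff: "is_pole f p \<longleftrightarrow> \<phi> p \<noteq> 0"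
    using pole npole is_pole_cong[OF eq' refl] by blast
  show "zorder f p = -1" if "is_pole f p"
  proof -
    have "zorder g p = -1"
      by (rule zorder_eqI[OF S(1,2), where g = "\<lambda>s. \<phi> s + \<psi> s * (s - p)"])
         (use S iff that in \<open>auto intro!: holomorphic_intros simp: g_def power_int_minus field_simps\<close>)
    then show ?thesis using zorder_cong[OF eq' refl] by simp
  qed
  have "g meromorphic_on {p}"
    unfolding g_def using phi[THEN analytic_on_imp_meromorphic_on] psi[THEN analytic_on_imp_meromorphic_on]
    by (intro meromorphic_intros)
  then show "f meromorphic_on {p}"
    using eq' by (subst meromorphic_on_cong[where g = g]) auto
qed

text \<open>The denominator has a simple zero at \<open>p\<close> with derivative \<open>c\<close>;
  dividing it by \<open>s - p\<close> leaves an entire function with value \<open>c\<close> at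
  \<open>p\<close>, and \<open>g\<close> is its reciprocal. The identity holds at \<open>p\<close>
  too, where both sides are 0 by \<open>x / 0 = 0\<close>.\<close>

lemma analytic_factor_one_minus_exp:
  fixes c p :: complex
  assumes "c \<noteq> 0"
  obtains g where "g analytic_on {p}" "g p = 1 / c"
    "\<forall>\<^sub>F s in nhds p. 1 / (1 - exp (- c * (s - p))) = g s / (s - p)"
proof -
  define f where "f = (\<lambda>s. 1 - exp (- c * (s - p)))"
  define q where "q = (\<lambda>s. if s = p then deriv f p else (f s - f p) / (s - p))"
  have "(f has_field_derivative c) (at p)"
    unfolding f_def by (auto intro!: derivative_eq_intros)
  then have qp: "q p = c" by (simp add: q_def DERIV_imp_deriv)
  have "q holomorphic_on UNIV"
    unfolding q_def by (intro pole_lemma_open) (auto simp: f_def intro!: holomorphic_intros)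
  then have q: "q analytic_on {p}" by (meson analytic_on_holomorphic open_UNIV subset_UNIV)
  show ?thesis
  proof
    show "(\<lambda>s. 1 / q s) analytic_on {p}"
      using q qp assms by (intro analytic_intros) auto
    show "\<forall>\<^sub>F s in nhds p. 1 / (1 - exp (- c * (s - p))) = 1 / q s / (s - p)"
      by (rule always_eventually) (auto simp: q_def f_def)
  qed (simp add: qp)
qed

lemma pochhammer_neg_of_nat:
  assumes "r \<le> m"
  shows "pochhammer (- of_nat m :: 'a :: field_char_0) r = (- 1) ^ r * fact m / fact (m - r)"
proof -
  have "of_nat (m choose r) = (- 1) ^ r * pochhammer (- of_nat m :: 'a) r / fact r"
    by (simp add: binomial_gbinomial gbinomial_pochhammer)
  then have "(- 1) ^ r * (- 1) ^ r * pochhammer (- of_nat m :: 'a) r = (- 1) ^ r * fact m / fact (m - r)"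
    using assms by (simp add: binomial_fact field_simps)
  then show ?thesis by (simp flip: power_add mult_2)
qed

text \<open>Triangle inequality factor by factor. It makes the majorants below uniform over the disc
  of radius \<open>S\<close>.\<close>

lemma norm_pochhammer_le:
  fixes s :: "'a :: real_normed_field"
  assumes "norm s \<le> S"
  shows "norm (pochhammer s m) \<le> pochhammer S m"
proof -
  have "norm (s + of_nat i) \<le> S + of_nat i" for i
    using norm_triangle_ineq[of s "of_nat i"] assms by simp
  then show ?thesis
    unfolding pochhammer_prod by (auto intro!: prod_mono simp flip: prod_norm)
qed

text \<open>These are the terms of the binomial series of \<open>(1 - r) powr (- S)\<close>.\<close>

lemma summable_pochhammer_power:
  fixes S r :: real
  assumes "\<bar>r\<bar> < 1"
  shows "summable (\<lambda>m. pochhammer S m / fact m * r ^ m)"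
proof -
  have "(\<lambda>m. ((- S) gchoose m) * (- r) ^ m) = (\<lambda>m. pochhammer S m / fact m * r ^ m)"
    by (rule ext) (simp add: gbinomial_pochhammer power_minus[of r] mult_ac flip: power_add mult_2)
  then show ?thesis using gen_binomial_real[of "- r" "- S"] assms by (auto simp: sums_iff)
qed

section \<open>The double series and its ingredients\<close>

text \<open>Terms with index below \<open>N\<close> are kept as they stand. From \<open>N\<close>
  on, the last assumption gives \<open>norm x\<^sub>n < 1\<close>, since both summands decrease with
  the exponent, so the binomial series converges. \<open>N \<ge> 1\<close> keeps index 0 out of the
  expansion, where \<open>lucas_U\<close> is not given by the quotient.\<close>

locale lucas_zeta =
  fixes a b :: real and z :: complex and N :: nat
  assumes a_gt_1: "a > 1" and abs_b_less: "\<bar>b\<bar> < a" and b_nonzero: "b \<noteq> 0"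
    and z_notin: "z \<notin> \<real>\<^sub>\<le>\<^sub>0" and N_pos: "N \<ge> 1"
    and ratio_less_1: "norm z * (a - b) * (1 / a) ^ N + (\<bar>b\<bar> / a) ^ N < 1"
begin

definition ratio :: real where
  "ratio = norm z * (a - b) * (1 / a) ^ N + (\<bar>b\<bar> / a) ^ N"

text \<open>The ratio \<open>a powr (- s - l - k) * b ^ k\<close> of the geometric series attached to \<open>(l, k)\<close>.\<close>
definition geom_ratio :: "nat \<Rightarrow> nat \<Rightarrow> complex \<Rightarrow> complex" where
  "geom_ratio l k s = exp (- of_real (ln a) * s) * of_real ((1 / a) ^ l * (b / a) ^ k)"

definition abs_ratio :: "nat \<Rightarrow> nat \<Rightarrow> real" where
  "abs_ratio l k = (1 / a) ^ l * (\<bar>b\<bar> / a) ^ k"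

text \<open>The exponential is \<open>(a - b) powr s\<close>, left over from the prefactor
  \<open>(a ^ n / (a - b)) powr (- s)\<close>, whose other part sits in \<open>geom_ratio\<close>.
  The Pochhammer quotient is the coefficient of the two-variable binomial expansion of exponent
  \<open>- s\<close>.\<close>

definition coef :: "nat \<Rightarrow> nat \<Rightarrow> complex \<Rightarrow> complex" where
  "coef l k s = exp (s * of_real (ln (a - b))) *
     (pochhammer s (l + k) / (fact l * fact k)) * (- z * of_real (a - b)) ^ l"

text \<open>Pairs \<open>(l, k)\<close> are grouped by \<open>m = l + k\<close>, so that the majorant is the binomial series of
  \<open>(1 - ratio) powr (- S)\<close>. At a zero of a denominator the summand is 0 because of \<open>x / 0 = 0\<close>.\<close>
definition diag_term :: "nat \<Rightarrow> complex \<Rightarrow> complex" where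
  "diag_term m s = (\<Sum>l\<le>m. coef l (m - l) s * geom_ratio l (m - l) s ^ N / (1 - geom_ratio l (m - l) s))"

text \<open>Values at zeros of the denominators are artefacts of \<open>x / 0 = 0\<close>; the final
  theorem corrects them by \<open>remove_sings\<close>.\<close>

definition zeta_cont :: "complex \<Rightarrow> complex" where
  "zeta_cont s = (\<Sum>n<N. (z + of_real (lucas_U a b n)) powr (- s)) + (\<Sum>m. diag_term m s)"

lemma a_pos: "a > 0" and lna_pos: "ln a > 0" and diff_pos: "a - b > 0"
  using a_gt_1 abs_b_less by auto

lemma ratio_nonneg: "ratio \<ge> 0"
  unfolding ratio_def using a_pos diff_pos by simp

lemma abs_ratio_pos: "abs_ratio l k > 0"
  using a_pos b_nonzero by (simp add: abs_ratio_def)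

lemma norm_geom_ratio: "norm (geom_ratio l k s) = exp (- ln a * Re s) * abs_ratio l k"
  using a_pos by (simp add: geom_ratio_def abs_ratio_def norm_mult norm_power norm_divide)

lemma lucas_U_pos: "lucas_U a b n > 0"
proof (cases "n = 0")
  case False
  then have "\<bar>b\<bar> ^ n < a ^ n" using abs_b_less by (intro power_strict_mono) auto
  then have "b ^ n < a ^ n" by (metis abs_ge_self order_le_less_trans power_abs)
  then show ?thesis using False diff_pos by (simp add: lucas_U_def)
qed (simp add: lucas_U_def)

lemma z_plus_pos_notin: "t > 0 \<Longrightarrow> z + of_real t \<notin> \<real>\<^sub>\<le>\<^sub>0"
  using z_notin by (auto simp: complex_nonpos_Reals_iff)

lemma holomorphic_geom_ratio [holomorphic_intros]: "geom_ratio l k holomorphic_on A"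
  unfolding geom_ratio_def by (intro holomorphic_intros)

lemma holomorphic_coef [holomorphic_intros]: "coef l k holomorphic_on A"
  unfolding coef_def by (intro holomorphic_intros) auto

section \<open>Convergence of the double series\<close>

text \<open>The pair \<open>(l, m - l)\<close> contributes at most a constant times
  \<open>m choose l\<close> times the matching powers of the two summands of \<open>ratio\<close>;
  summed over \<open>l\<close>, the binomial theorem turns this into
  \<open>ratio ^ m\<close>.\<close>

lemma coef_sum_bound:
  assumes "norm s \<le> S"
  shows "(\<Sum>l\<le>m. norm (coef l (m - l) s) * abs_ratio l (m - l) ^ N)
           \<le> exp (S * \<bar>ln (a - b)\<bar>) * (pochhammer S m / fact m * ratio ^ m)"
proof -
  have Re: "Re s * ln (a - b) \<le> S * \<bar>ln (a - b)\<bar>"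
  proof -
    have "Re s * ln (a - b) \<le> \<bar>Re s\<bar> * \<bar>ln (a - b)\<bar>"
      by (metis abs_ge_self abs_mult)
    also have "\<dots> \<le> S * \<bar>ln (a - b)\<bar>"
      using abs_Re_le_cmod[of s] assms by (intro mult_right_mono) auto
    finally show ?thesis .
  qed
  have "norm (coef l (m - l) s) * abs_ratio l (m - l) ^ N \<le>
      exp (S * \<bar>ln (a - b)\<bar>) * (pochhammer S m / fact m) *
      (of_nat (m choose l) * (norm z * (a - b) * (1 / a) ^ N) ^ l * ((\<bar>b\<bar> / a) ^ N) ^ (m - l))"
    if "l \<le> m" for l
  proof -
    have yN: "abs_ratio l (m - l) ^ N = ((1 / a) ^ N) ^ l * ((\<bar>b\<bar> / a) ^ N) ^ (m - l)"
      by (simp add: abs_ratio_def power_mult_distrib flip: power_mult) (simp add: mult.commute)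
    have "norm (coef l (m - l) s) = exp (Re s * ln (a - b)) *
        (norm (pochhammer s m) / (fact l * fact (m - l))) * (norm z * (a - b)) ^ l"
      using that diff_pos norm_of_real[of "a - b", where ?'a = complex]
      by (simp add: coef_def norm_mult norm_divide norm_power norm_fact del: norm_of_real)
    also have "\<dots> \<le> exp (S * \<bar>ln (a - b)\<bar>) *
        (pochhammer S m / (fact l * fact (m - l))) * (norm z * (a - b)) ^ l"
      using Re diff_pos norm_pochhammer_le[OF assms, of m]
        order_trans[OF norm_ge_zero norm_pochhammer_le[OF assms, of m]]
      by (intro mult_mono divide_right_mono mult_nonneg_nonneg divide_nonneg_nonneg) auto
    finally have "norm (coef l (m - l) s) * abs_ratio l (m - l) ^ N \<le>
        exp (S * \<bar>ln (a - b)\<bar>) * (pochhammer S m / (fact l * fact (m - l))) *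
        (norm z * (a - b)) ^ l * abs_ratio l (m - l) ^ N"
      using abs_ratio_pos[of l "m - l"] by (intro mult_right_mono) auto
    also have "pochhammer S m / (fact l * fact (m - l)) = pochhammer S m / fact m * of_nat (m choose l)"
      using that by (simp add: binomial_fact)
    finally show ?thesis using yN by (simp add: power_mult_distrib mult_ac)
  qed
  then have "(\<Sum>l\<le>m. norm (coef l (m - l) s) * abs_ratio l (m - l) ^ N) \<le>
     (\<Sum>l\<le>m. exp (S * \<bar>ln (a - b)\<bar>) * (pochhammer S m / fact m) *
      (of_nat (m choose l) * (norm z * (a - b) * (1 / a) ^ N) ^ l * ((\<bar>b\<bar> / a) ^ N) ^ (m - l)))"
    by (intro sum_mono) auto
  also have "\<dots> = exp (S * \<bar>ln (a - b)\<bar>) * (pochhammer S m / fact m) * ratio ^ m"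
    by (simp add: sum_distrib_left ratio_def binomial_ring)
  finally show ?thesis by (simp add: mult_ac)
qed

lemma summable_majorant: "summable (\<lambda>m. pochhammer S m / fact m * ratio ^ m)"
  using ratio_nonneg ratio_less_1 by (intro summable_pochhammer_power) (auto simp: ratio_def)

text \<open>On the disc the norm is at most \<open>exp (ln a * S) * g ^ (l + k)\<close> with
  \<open>g < 1\<close>. The bound 1/2 keeps \<open>1 - geom_ratio l k s\<close> away from 0, so only
  the finitely many pairs with \<open>l + k < M\<close> can be singular in the disc.\<close>

lemma geom_ratio_eventually_small:
  obtains M where "\<And>l k s. l + k \<ge> M \<Longrightarrow> norm s \<le> S \<Longrightarrow> norm (geom_ratio l k s) \<le> 1 / 2"
proof -
  define g where "g = max (1 / a) (\<bar>b\<bar> / a)"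
  have g: "0 < g" "g < 1" using a_gt_1 abs_b_less by (auto simp: g_def less_max_iff_disj)
  have "(\<lambda>m. exp (ln a * S) * g ^ m) \<longlonglongrightarrow> exp (ln a * S) * 0"
    using g by (intro tendsto_mult tendsto_const LIMSEQ_power_zero) auto
  then have "\<forall>\<^sub>F m in sequentially. exp (ln a * S) * g ^ m < 1 / 2"
    by (rule order_tendstoD) simp
  then obtain M where M: "\<And>m. m \<ge> M \<Longrightarrow> exp (ln a * S) * g ^ m < 1 / 2"
    by (auto simp: eventually_sequentially)
  show ?thesis
  proof
    fix l k and s :: complex
    assume lk: "l + k \<ge> M" and s: "norm s \<le> S"
    have "abs_ratio l k \<le> g ^ l * g ^ k"
      unfolding abs_ratio_def using a_pos g(1) by (intro mult_mono power_mono) (auto simp: g_def)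
    moreover have "- ln a * Re s \<le> ln a * S"
      using abs_Re_le_cmod[of s] s lna_pos mult_left_mono[of "- Re s" S "ln a"] by auto
    ultimately have "norm (geom_ratio l k s) \<le> exp (ln a * S) * (g ^ l * g ^ k)"
      unfolding norm_geom_ratio using abs_ratio_pos[of l k] by (intro mult_mono) auto
    also have "\<dots> \<le> 1 / 2" using M[OF lk] by (simp add: power_add)
    finally show "norm (geom_ratio l k s) \<le> 1 / 2" .
  qed
qed

text \<open>From \<open>M\<close> on, the reciprocal denominators have norm at most 2, so
  \<open>coef_sum_bound\<close> supplies a majorant for the Weierstrass test. Summability holds even
  at singular points, as the finitely many earlier terms do not affect it.\<close>

lemma diag_term_tail:
  assumes small: "\<And>l k s. l + k \<ge> M \<Longrightarrow> norm s \<le> S \<Longrightarrow> norm (geom_ratio l k s) \<le> 1 / 2"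
  shows "(\<lambda>s. \<Sum>m. diag_term (m + M) s) holomorphic_on ball 0 S"
    and "\<And>s. norm s \<le> S \<Longrightarrow> summable (\<lambda>m. diag_term m s)"
proof -
  \<comment> \<open>The factor 2 bounds the reciprocal denominator, the second factor the
    \<open>N\<close>-th power of the exponential in \<open>geom_ratio\<close>, and the third comes
    from \<open>coef_sum_bound\<close>.\<close>
  define c where "c = 2 * exp (ln a * S) ^ N * exp (S * \<bar>ln (a - b)\<bar>)"
  define B where "B = (\<lambda>m. c * (pochhammer S m / fact m * ratio ^ m))"
  have bound: "norm (diag_term m s) \<le> B m" if "m \<ge> M" "norm s \<le> S" for m s
  proof -
    have "norm (coef l (m - l) s * geom_ratio l (m - l) s ^ N / (1 - geom_ratio l (m - l) s)) \<le>
        2 * exp (ln a * S) ^ N * (norm (coef l (m - l) s) * abs_ratio l (m - l) ^ N)" if l: "l \<le> m" for l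
    proof -
      have "norm (geom_ratio l (m - l) s) \<le> 1 / 2" using small[of l "m - l" s] l \<open>m \<ge> M\<close> \<open>norm s \<le> S\<close> by simp
      then have "1 / norm (1 - geom_ratio l (m - l) s) \<le> 2"
        using norm_triangle_ineq2[of 1 "geom_ratio l (m - l) s"] by (subst divide_le_eq) auto
      moreover have "- ln a * Re s \<le> ln a * S"
        using abs_Re_le_cmod[of s] \<open>norm s \<le> S\<close> lna_pos mult_left_mono[of "- Re s" S "ln a"] by auto
      then have "norm (geom_ratio l (m - l) s) ^ N \<le> exp (ln a * S) ^ N * abs_ratio l (m - l) ^ N"
        unfolding norm_geom_ratio power_mult_distrib using abs_ratio_pos[of l "m - l"]
        by (intro mult_right_mono power_mono) auto
      ultimately have "norm (coef l (m - l) s) *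
          (norm (geom_ratio l (m - l) s) ^ N * (1 / norm (1 - geom_ratio l (m - l) s)))
         \<le> norm (coef l (m - l) s) * (exp (ln a * S) ^ N * abs_ratio l (m - l) ^ N * 2)"
        using abs_ratio_pos[of l "m - l"] by (intro mult_mono mult_nonneg_nonneg) auto
      then show ?thesis by (simp add: norm_mult norm_divide norm_power mult_ac)
    qed
    then have "norm (diag_term m s) \<le>
        2 * exp (ln a * S) ^ N * (\<Sum>l\<le>m. norm (coef l (m - l) s) * abs_ratio l (m - l) ^ N)"
      unfolding diag_term_def sum_distrib_left by (intro sum_norm_le) auto
    also have "\<dots> \<le> 2 * exp (ln a * S) ^ N *
        (exp (S * \<bar>ln (a - b)\<bar>) * (pochhammer S m / fact m * ratio ^ m))"
      using coef_sum_bound[OF \<open>norm s \<le> S\<close>] by (intro mult_left_mono) auto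
    finally show ?thesis by (simp add: B_def c_def mult_ac)
  qed
  have sumB: "summable B" unfolding B_def by (intro summable_mult summable_majorant)
  then have sumB': "summable (\<lambda>m. B (m + M))" by simp
  show "summable (\<lambda>m. diag_term m s)" if "norm s \<le> S" for s
    by (rule summable_comparison_test'[OF sumB, of M]) (use bound that in auto)
  have lim: "uniform_limit (cball 0 S) (\<lambda>n s. \<Sum>m<n. diag_term (m + M) s)
      (\<lambda>s. \<Sum>m. diag_term (m + M) s) sequentially"
    by (rule Weierstrass_m_test[OF _ sumB']) (use bound in auto)
  have hol: "diag_term m holomorphic_on cball 0 S" if "m \<ge> M" for m
  proof -
    have "1 - geom_ratio l (m - l) s \<noteq> 0" if "l \<le> m" "s \<in> cball 0 S" for l s
      using small[of l "m - l" s] that \<open>m \<ge> M\<close> by auto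
    then show ?thesis unfolding diag_term_def by (intro holomorphic_intros) auto
  qed
  then have "(\<lambda>s. \<Sum>m<n. diag_term (m + M) s) holomorphic_on cball 0 S" for n
    by (intro holomorphic_intros) auto
  then have "\<forall>\<^sub>F n in sequentially. continuous_on (cball 0 S) (\<lambda>s. \<Sum>m<n. diag_term (m + M) s) \<and>
      (\<lambda>s. \<Sum>m<n. diag_term (m + M) s) holomorphic_on ball 0 S"
    by (intro always_eventually allI conjI)
       (auto intro: holomorphic_on_imp_continuous_on holomorphic_on_subset[OF _ ball_subset_cball])
  from holomorphic_uniform_limit[OF this lim] show "(\<lambda>s. \<Sum>m. diag_term (m + M) s) holomorphic_on ball 0 S"
    by auto
qed

section \<open>Local form of the continuation at a point\<close>

lemma geom_ratio_shift: "geom_ratio l k s = geom_ratio l k p * exp (- of_real (ln a) * (s - p))"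
  by (simp add: geom_ratio_def exp_add[symmetric] algebra_simps)

definition resonant :: "complex \<Rightarrow> (nat \<times> nat) set" where
  "resonant p = {(l, k). geom_ratio l k p = 1}"

lemma finite_resonant: "finite (resonant p)"
proof -
  obtain M where M: "\<And>l k s. l + k \<ge> M \<Longrightarrow> norm s \<le> norm p \<Longrightarrow> norm (geom_ratio l k s) \<le> 1 / 2"
    using geom_ratio_eventually_small[of "norm p"] by blast
  have "resonant p \<subseteq> {..M} \<times> {..M}"
  proof (clarsimp simp: resonant_def)
    fix l k assume "geom_ratio l k p = 1"
    then have "\<not> l + k \<ge> M" using M[of l k p] by auto
    then show "l \<le> M \<and> k \<le> M" by auto
  qed
  then show ?thesis by (rule finite_subset) auto
qed

text \<open>By \<open>geom_ratio_shift\<close> all resonant pairs have the same denominator near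
  \<open>p\<close>, so one factor \<open>g s / (s - p)\<close> serves them all;
  \<open>\<psi>\<close> collects everything else. The identity is stated on \<open>nhds p\<close>,
  not just on a punctured neighbourhood, so that it yields analyticity of \<open>zeta_cont\<close>
  when no pair is resonant.\<close>

lemma zeta_cont_local_form:
  obtains g \<psi> where "g analytic_on {p}" "g p = 1 / of_real (ln a)" "\<psi> analytic_on {p}"
    "\<forall>\<^sub>F s in nhds p. zeta_cont s =
      (\<Sum>(l, k)\<in>resonant p. coef l k s * geom_ratio l k s ^ N) * g s / (s - p) + \<psi> s"
proof -
  define S where "S = norm p + 1"
  obtain M where M: "\<And>l k s. l + k \<ge> M \<Longrightarrow> norm s \<le> S \<Longrightarrow> norm (geom_ratio l k s) \<le> 1 / 2"
    using geom_ratio_eventually_small[of S] by blast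
  obtain g where g: "g analytic_on {p}" "g p = 1 / of_real (ln a)"
    "\<forall>\<^sub>F s in nhds p. 1 / (1 - exp (- of_real (ln a) * (s - p))) = g s / (s - p)"
    using analytic_factor_one_minus_exp[of "of_real (ln a)" p] lna_pos by auto
  \<comment> \<open>\<open>I\<close> lists the terms below \<open>M\<close> in the diagonal indexing
    \<open>(m, l)\<close>; \<open>J\<close> is the same list indexed by \<open>(l, k)\<close>, so
    that the resonant pairs can be split off.\<close>
  define I where "I = (SIGMA m:{..<M}. {..m})"
  define J where "J = (\<lambda>(m, l). (l, m - l)) ` I"
  define t where "t = (\<lambda>(l, k) s. coef l k s * geom_ratio l k s ^ N / (1 - geom_ratio l k s))"
  define \<psi> where "\<psi> = (\<lambda>s. (\<Sum>n<N. (z + of_real (lucas_U a b n)) powr (- s)) +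
      (\<Sum>m. diag_term (m + M) s) + (\<Sum>lk\<in>J - resonant p. t lk s))"
  have "finite J" by (simp add: J_def I_def)
  have inj: "inj_on (\<lambda>(m, l). (l, m - l)) I"
    by (auto simp: inj_on_def I_def)
  have J: "(l, k) \<in> J \<longleftrightarrow> l + k < M" for l k
    by (auto simp: J_def I_def image_iff intro!: bexI[of _ "l + k"])
  have "resonant p \<subseteq> J"
  proof clarify
    fix l k assume "(l, k) \<in> resonant p"
    then have "\<not> l + k \<ge> M" using M[of l k p] by (auto simp: resonant_def S_def)
    then show "(l, k) \<in> J" using J by simp
  qed
  have head: "(\<Sum>m<M. diag_term m s) = (\<Sum>lk\<in>J. t lk s)" for s
    unfolding J_def sum.reindex[OF inj]
    by (simp add: diag_term_def t_def I_def sum.Sigma case_prod_unfold)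
  have psi: "\<psi> analytic_on {p}"
  proof -
    have "p \<in> ball 0 S" by (simp add: S_def)
    then have "(\<lambda>s. \<Sum>m. diag_term (m + M) s) analytic_on {p}"
      using diag_term_tail(1)[OF M] by (meson analytic_at open_ball)
    moreover have "t lk analytic_on {p}" if "lk \<in> J - resonant p" for lk
    proof -
      obtain l k where lk: "lk = (l, k)" by force
      have "coef l k analytic_on {p}" "geom_ratio l k analytic_on {p}"
        using analytic_at[of _ p] holomorphic_coef[of l k UNIV] holomorphic_geom_ratio[of l k UNIV] by auto
      moreover have "1 - geom_ratio l k p \<noteq> 0" using that by (auto simp: lk resonant_def)
      ultimately show ?thesis unfolding lk t_def prod.case by (intro analytic_intros) auto
    qed
    moreover have "(\<lambda>s. (z + of_real (lucas_U a b n)) powr (- s)) analytic_on {p}" for n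
      using z_plus_pos_notin[OF lucas_U_pos[of n]]
      by (intro analytic_on_powr analytic_intros) auto
    ultimately show ?thesis unfolding \<psi>_def by (intro analytic_on_add analytic_on_sum) auto
  qed
  have "\<forall>\<^sub>F s in nhds p. s \<in> ball 0 S"
    by (intro eventually_nhds_in_open) (auto simp: S_def)
  with g(3) have "\<forall>\<^sub>F s in nhds p. zeta_cont s =
      (\<Sum>(l, k)\<in>resonant p. coef l k s * geom_ratio l k s ^ N) * g s / (s - p) + \<psi> s"
  proof eventually_elim
    case (elim s)
    have "summable (\<lambda>m. diag_term m s)" using diag_term_tail(2)[OF M] elim by auto
    then have "(\<Sum>m. diag_term m s) = (\<Sum>m. diag_term (m + M) s) + (\<Sum>lk\<in>J. t lk s)"
      unfolding head[symmetric] by (rule suminf_split_initial_segment)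
    also have "(\<Sum>lk\<in>J. t lk s) = (\<Sum>lk\<in>J - resonant p. t lk s) + (\<Sum>lk\<in>resonant p. t lk s)"
      using \<open>finite J\<close> \<open>resonant p \<subseteq> J\<close> by (rule sum.subset_diff[rotated])
    also have "(\<Sum>lk\<in>resonant p. t lk s) =
        (\<Sum>(l, k)\<in>resonant p. coef l k s * geom_ratio l k s ^ N * (g s / (s - p)))"
    proof (rule sum.cong)
      fix lk assume "lk \<in> resonant p"
      \<comment> \<open>At \<open>s = p\<close> both sides are 0, again by
        \<open>x / 0 = 0\<close>.\<close>
      then show "t lk s = (case lk of (l, k) \<Rightarrow> coef l k s * geom_ratio l k s ^ N * (g s / (s - p)))"
        using geom_ratio_shift[of _ _ s p] elim(1) by (auto simp: resonant_def t_def divide_simps split: if_splits)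
    qed simp
    also have "\<dots> = (\<Sum>(l, k)\<in>resonant p. coef l k s * geom_ratio l k s ^ N) * g s / (s - p)"
      by (simp add: sum_distrib_right case_prod_unfold sum_divide_distrib)
    finally show ?case by (simp add: zeta_cont_def \<psi>_def)
  qed
  with g psi show ?thesis using that by blast
qed

section \<open>Agreement with the zeta series for positive real part\<close>

text \<open>For \<open>Re s > 0\<close> every geometric ratio has norm below 1, so each
  \<open>diag_term\<close> is a convergent sum over \<open>n\<close>, and the two summations may be
  interchanged.\<close>

lemma zeta_eq_zeta_cont:
  assumes s: "Re s > 0"
  shows "summable (\<lambda>n. (z + of_real (lucas_U a b n)) powr (- s))" and "zeta_U a b s z = zeta_cont s"
proof -
  define q where "q = exp (- ln a * Re s)"
  have q: "0 < q" "q < 1" using s lna_pos by (auto simp: q_def)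
  have abs_ratio_le: "abs_ratio l k \<le> 1" for l k
    unfolding abs_ratio_def using a_gt_1 abs_b_less by (intro mult_le_one power_le_one) auto
  have norm_geom_ratio_less: "norm (geom_ratio l k s) < 1" for l k
    unfolding norm_geom_ratio q_def[symmetric] using q abs_ratio_le[of l k] abs_ratio_pos[of l k]
    by (metis less_eq_real_def mult_less_cancel_right2 mult_mono order_le_less_trans mult.right_neutral)
  \<comment> \<open>\<open>f n m\<close> is the part of degree \<open>m\<close> in the expansion of
    the term with index \<open>n + N\<close>: row sums return the terms of the zeta series, column
    sums are the \<open>diag_term\<close>s.\<close>
  define f where "f = (\<lambda>n m. \<Sum>l\<le>m. coef l (m - l) s * geom_ratio l (m - l) s ^ (n + N))"
  define B where "B = (\<lambda>m. exp (norm s * \<bar>ln (a - b)\<bar>) * (pochhammer (norm s) m / fact m * ratio ^ m))"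
  define u where "u = (\<lambda>n. (z + of_real (lucas_U a b n)) powr (- s))"
  have bound: "norm (f n m) \<le> q ^ n * B m" for n m
  proof -
    have "norm (coef l (m - l) s * geom_ratio l (m - l) s ^ (n + N)) \<le>
        q ^ n * (norm (coef l (m - l) s) * abs_ratio l (m - l) ^ N)" for l
    proof -
      have "norm (geom_ratio l (m - l) s) ^ (n + N) = q ^ n * q ^ N * (abs_ratio l (m - l) ^ n * abs_ratio l (m - l) ^ N)"
        unfolding norm_geom_ratio q_def[symmetric] by (simp add: power_mult_distrib power_add)
      also have "\<dots> \<le> q ^ n * 1 * (1 * abs_ratio l (m - l) ^ N)"
        using q abs_ratio_le[of l "m - l"] abs_ratio_pos[of l "m - l"]
        by (intro mult_mono power_le_one mult_nonneg_nonneg) auto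
      finally have "norm (geom_ratio l (m - l) s) ^ (n + N) \<le> q ^ n * abs_ratio l (m - l) ^ N" by simp
      from mult_left_mono[OF this norm_ge_zero[of "coef l (m - l) s"]] show ?thesis
        by (simp add: norm_mult norm_power mult.left_commute)
    qed
    then have "norm (f n m) \<le> q ^ n * (\<Sum>l\<le>m. norm (coef l (m - l) s) * abs_ratio l (m - l) ^ N)"
      unfolding f_def sum_distrib_left by (intro sum_norm_le) auto
    also have "\<dots> \<le> q ^ n * B m"
      unfolding B_def using q coef_sum_bound[OF order_refl] by (intro mult_left_mono) auto
    finally show ?thesis .
  qed
  have col: "(\<lambda>n. f n m) sums diag_term m s" for m
  proof -
    have "(\<lambda>n. coef l k s * geom_ratio l k s ^ N * geom_ratio l k s ^ n) sums
        (coef l k s * geom_ratio l k s ^ N * (1 / (1 - geom_ratio l k s)))" for l k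
      by (intro sums_mult geometric_sums norm_geom_ratio_less)
    then have "(\<lambda>n. coef l k s * geom_ratio l k s ^ (n + N)) sums
        (coef l k s * geom_ratio l k s ^ N / (1 - geom_ratio l k s))" for l k
      by (simp add: power_add mult_ac)
    then show ?thesis unfolding f_def diag_term_def by (intro sums_sum)
  qed
  have row: "(\<lambda>m. f n m) sums u (n + N)" for n
  proof -
    define j where "j = n + N"
    \<comment> \<open>This is \<open>- x\<^sub>j\<close> in the notation of the opening remarks,
      while \<open>E\<close> is \<open>(a ^ j / (a - b)) powr (- s)\<close>.\<close>
    define v where "v = z * of_real (a - b) * of_real ((1 / a) ^ j) - of_real ((b / a) ^ j)"
    define E where "E = exp (s * of_real (ln (a - b))) * exp (- of_real (ln a) * s) ^ j"
    have "norm v \<le> norm (z * of_real (a - b) * of_real ((1 / a) ^ j)) + norm (of_real ((b / a) ^ j) :: complex)"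
      unfolding v_def by (rule norm_triangle_ineq4)
    also have "\<dots> = norm z * (a - b) * (1 / a) ^ j + (\<bar>b\<bar> / a) ^ j"
      unfolding norm_mult norm_of_real using diff_pos a_pos by (simp add: power_abs abs_mult)
    also have "\<dots> \<le> ratio"
      unfolding ratio_def j_def using diff_pos a_gt_1 abs_b_less
      by (intro add_mono mult_left_mono power_decreasing) auto
    finally have v: "norm v < 1" using ratio_less_1 by (simp add: ratio_def)
    then have v': "1 + v \<noteq> 0" by (metis add_eq_0_iff norm_minus_cancel norm_one order_less_irrefl)
    \<comment> \<open>The quotient formula for \<open>lucas_U\<close> applies because
      \<open>j \<ge> N \<ge> 1\<close>.\<close>
    have "z + of_real (lucas_U a b j) = of_real (a ^ j / (a - b)) * (1 + v)"
      using N_pos diff_pos a_pos by (simp add: lucas_U_def j_def v_def field_simps)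
    \<comment> \<open>The principal logarithm is additive here because the first factor is a
      positive real.\<close>
    moreover have "Ln (of_real (a ^ j / (a - b)) * (1 + v)) = of_real (ln (a ^ j / (a - b))) + Ln (1 + v)"
      using Ln_times_of_real[OF _ v', of "a ^ j / (a - b)"] diff_pos a_pos
      by (simp add: Ln_of_real del: of_real_divide of_real_power of_real_diff)
    moreover have "of_real (a ^ j / (a - b)) * (1 + v) \<noteq> 0"
      unfolding mult_eq_0_iff of_real_eq_0_iff using v' diff_pos a_pos by simp
    ultimately have "u j = exp (- s * (of_real (ln (a ^ j / (a - b))) + Ln (1 + v)))"
      unfolding u_def powr_def by metis
    also have "ln (a ^ j / (a - b)) = real j * ln a - ln (a - b)"
      using diff_pos a_pos by (simp add: ln_div ln_realpow)
    also have "exp (- s * (of_real (real j * ln a - ln (a - b)) + Ln (1 + v))) = E * (1 + v) powr (- s)"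
      unfolding E_def exp_of_nat_mult[symmetric] powr_def using v'
      by (simp add: exp_add[symmetric] algebra_simps)
    finally have u: "u j = E * (1 + v) powr (- s)" .
    have "f n m = E * ((- s gchoose m) * v ^ m)" for m
    proof -
      have "(- s gchoose m) * v ^ m = pochhammer s m / fact m * (- v) ^ m"
        by (simp add: gbinomial_pochhammer power_minus[of v])
      also have "- v = - z * of_real (a - b) * of_real ((1 / a) ^ j) + of_real ((b / a) ^ j)"
        by (simp add: v_def)
      finally have "E * ((- s gchoose m) * v ^ m) = (\<Sum>l\<le>m. E * (pochhammer s m / fact m *
          (of_nat (m choose l) * (- z * of_real (a - b) * of_real ((1 / a) ^ j)) ^ l * of_real ((b / a) ^ j) ^ (m - l))))"
        by (simp only: binomial_ring sum_distrib_left)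
      also have "\<dots> = f n m"
        unfolding f_def
      proof (rule sum.cong)
        fix l assume "l \<in> {..m}"
        then have l: "l \<le> m" by simp
        have "geom_ratio l (m - l) s ^ j =
            exp (- of_real (ln a) * s) ^ j * (of_real ((1 / a) ^ j) ^ l * of_real ((b / a) ^ j) ^ (m - l))"
          unfolding geom_ratio_def power_mult_distrib of_real_mult of_real_power power_mult[symmetric] mult.commute[of j] ..
        then show "E * (pochhammer s m / fact m *
          (of_nat (m choose l) * (- z * of_real (a - b) * of_real ((1 / a) ^ j)) ^ l * of_real ((b / a) ^ j) ^ (m - l)))
            = coef l (m - l) s * geom_ratio l (m - l) s ^ (n + N)"
          unfolding j_def[symmetric] coef_def E_def power_mult_distrib[of "- z * of_real (a - b)"] using l
          by (simp add: binomial_fact)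
      qed simp
      finally show ?thesis ..
    qed
    then show ?thesis
      using sums_mult[OF gen_binomial_complex[OF v, of "- s"], of E] u by (simp add: j_def)
  qed
  have "summable ((^) q)" using q by (intro summable_geometric) auto
  moreover have "summable B" unfolding B_def by (intro summable_mult summable_majorant)
  moreover have "B m \<ge> 0" for m
    unfolding B_def using ratio_nonneg s by (auto intro!: mult_nonneg_nonneg divide_nonneg_nonneg pochhammer_nonneg)
  ultimately have *: "(\<lambda>n. u (n + N)) sums (\<Sum>m. diag_term m s)"
    using sums_swap_of_product_bound[OF bound _ _ _ _ row col] q by auto
  then have summ: "summable u" using summable_iff_shift[of u N] by (simp add: sums_iff)
  then show "summable (\<lambda>n. (z + of_real (lucas_U a b n)) powr (- s))" by (simp add: u_def)
  have "zeta_U a b s z = (\<Sum>n. u (n + N)) + (\<Sum>n<N. u n)"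
    unfolding zeta_U_def u_def[symmetric] by (rule suminf_split_initial_segment[OF summ])
  then show "zeta_U a b s z = zeta_cont s"
    using * by (simp add: zeta_cont_def u_def sums_iff add.commute)
qed

section \<open>Zeros of the denominators and their residues\<close>

abbreviation "pole \<equiv> pole_lkn (a * b) a b"

lemma log_ratio_less_1: "log_ratio a b < 1"
proof -
  have "ln \<bar>b\<bar> < ln a" using abs_b_less b_nonzero by (subst ln_less_cancel_iff) auto
  then show ?thesis using lna_pos by (simp add: log_ratio_def)
qed

lemma Re_pole: "Re (pole l k n) = - real l - real k * (1 - log_ratio a b)"
  by (simp add: pole_lkn_def imag_shift_def Re_divide_of_real)

lemma Im_pole: "Im (pole l k n) = (2 * real_of_int n + real (l_index (a * b) k)) * pi / ln a"
  by (simp add: pole_lkn_def imag_shift_def Im_divide_of_real)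

lemma pole_inj:
  assumes "pole l k n = pole l k n'"
  shows "n = n'"
proof -
  have "Im (pole l k n) = Im (pole l k n')" using assms by (rule arg_cong)
  then show ?thesis unfolding Im_pole using lna_pos by simp
qed

text \<open>The integer \<open>n\<close> only adds a multiple of \<open>2 * pi * \<i>\<close> to the
  exponent. The shift \<open>l_index\<close> produces the sign of \<open>b ^ k\<close>: as
  \<open>a > 0\<close>, the product \<open>a * b\<close> is negative exactly when \<open>b\<close>
  is, and then the extra \<open>k * pi * \<i>\<close> gives \<open>(- 1) ^ k\<close>.\<close>

lemma geom_ratio_eq_exp_pole: "geom_ratio l k s = exp (of_real (ln a) * (pole l k n - s))"
proof -
  define i where "i = l_index (a * b) k"
  have "of_real (ln a) * (pole l k n - s) = - of_real (ln a) * s +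
      of_real (- real l * ln a + real k * (ln \<bar>b\<bar> - ln a)) +
      (of_int (2 * n) * of_real pi * \<i> + of_nat i * (of_real pi * \<i>))"
    using lna_pos by (simp add: pole_lkn_def imag_shift_def log_ratio_def i_def field_simps)
  also have "exp \<dots> = exp (- of_real (ln a) * s) *
      of_real (exp (- real l * ln a + real k * (ln \<bar>b\<bar> - ln a))) *
      (exp (of_int (2 * n) * of_real pi * \<i>) * exp (of_nat i * (of_real pi * \<i>)))"
    by (simp only: exp_add exp_of_real)
  also have "exp (of_int (2 * n) * of_real pi * \<i>) = 1"
    by (auto simp: exp_eq_1)
  also have "exp (of_nat i * (of_real pi * \<i>)) = (- 1) ^ i"
    by (simp add: exp_of_nat_mult)
  also have "exp (- real l * ln a + real k * (ln \<bar>b\<bar> - ln a)) = (1 / a) ^ l * (\<bar>b\<bar> / a) ^ k"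
    using a_pos b_nonzero
    by (simp add: exp_add exp_diff exp_minus exp_of_nat_mult power_divide divide_simps right_diff_distrib)
  also have "exp (- of_real (ln a) * s) * of_real ((1 / a) ^ l * (\<bar>b\<bar> / a) ^ k) * (1 * (- 1) ^ i) = geom_ratio l k s"
  proof -
    have "(\<bar>b\<bar> / a) ^ k * (- 1) ^ i = (b / a) ^ k"
    proof (cases "b < 0")
      case True
      then have "i = k" using a_pos by (simp add: i_def l_index_def mult_pos_neg)
      then show ?thesis using True by (simp flip: power_mult_distrib)
    next
      case False
      then have "i = 0" using a_pos by (simp add: i_def l_index_def mult_less_0_iff)
      then show ?thesis using False by simp
    qed
    then have "of_real ((\<bar>b\<bar> / a) ^ k) * (- 1) ^ i = (of_real ((b / a) ^ k) :: complex)"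
      by (metis of_real_1 of_real_minus of_real_mult of_real_power)
    then show ?thesis unfolding geom_ratio_def of_real_mult by (simp only: mult.assoc mult_1_left)
  qed
  finally show ?thesis ..
qed

lemma resonant_iff: "(l, k) \<in> resonant p \<longleftrightarrow> (\<exists>n. pole l k n = p)"
proof
  assume "(l, k) \<in> resonant p"
  then have "exp (of_real (ln a) * (pole l k 0 - p)) = 1"
    by (simp add: resonant_def geom_ratio_eq_exp_pole[of l k p 0])
  then obtain n :: int where "Re (of_real (ln a) * (pole l k 0 - p)) = 0"
    "Im (of_real (ln a) * (pole l k 0 - p)) = of_int (2 * n) * pi"
    unfolding exp_eq_1 by blast
  then have "Re (pole l k 0) = Re p" "Im (pole l k 0) - Im p = of_int (2 * n) * pi / ln a"
    using lna_pos by (auto simp: field_simps)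
  then have "pole l k (- n) = p"
    unfolding complex_eq_iff Re_pole Im_pole by (simp add: add_divide_distrib left_diff_distrib distrib_right diff_divide_distrib)
  then show "\<exists>n. pole l k n = p" ..
next
  assume "\<exists>n. pole l k n = p"
  then obtain n where "pole l k n = p" ..
  then show "(l, k) \<in> resonant p" by (simp add: resonant_def geom_ratio_eq_exp_pole[of l k p n])
qed

text \<open>With \<open>p\<close> the pole, the two powers of \<open>(a - b)\<^sup>2\<close> combine
  to \<open>(a - b) powr (p + l)\<close>, whose extra \<open>(a - b) ^ l\<close> is the one inside
  \<open>coef\<close>. The substitution \<open>j \<mapsto> l + k - j\<close> turns the product into
  \<open>pochhammer p (l + k)\<close>.\<close>

lemma coef_at_pole: "coef l k (pole l k n) / of_real (ln a) = res_lkn (a * b) ((a - b)\<^sup>2) a b z l k n"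
proof -
  define L where "L = ln (a - b)"
  define d where "d = complex_of_real (a - b)"
  define p where "p = pole l k n"
  have "ln ((a - b)\<^sup>2) = 2 * L" using diff_pos by (simp add: L_def ln_realpow)
  then have D: "of_real ((a - b)\<^sup>2) powr x = exp (x * (2 * of_real L))" for x :: complex
    using diff_pos by (simp add: powr_def Ln_of_real del: of_real_power)
  have e: "(of_real (real k / 2 * (log_ratio a b - 1)) +
        of_nat (l_index (a * b) k) * of_real pi * \<i> / (2 * of_real (ln a))) * (2 * of_real L) +
      of_int n * of_real pi * \<i> / of_real (ln a) * (2 * of_real L) = (p + of_nat l) * of_real L"
    using lna_pos by (simp add: p_def pole_lkn_def imag_shift_def field_simps)
  have "C_coeff (a * b) ((a - b)\<^sup>2) a b k *
      of_real ((a - b)\<^sup>2) powr (of_int n * of_real pi * \<i> / of_real (ln a))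
      = 1 / (fact k * of_real (ln a)) * exp ((p + of_nat l) * of_real L)"
    unfolding C_coeff_def D e[symmetric] exp_add by (simp only: mult.assoc)
  also have "exp ((p + of_nat l) * of_real L) = exp (p * of_real L) * d ^ l"
  proof -
    have "exp (of_real L) = d" using diff_pos by (simp add: L_def d_def exp_of_real)
    then show ?thesis by (simp add: distrib_right exp_add exp_of_nat_mult)
  qed
  finally have 1: "C_coeff (a * b) ((a - b)\<^sup>2) a b k *
      of_real ((a - b)\<^sup>2) powr (of_int n * of_real pi * \<i> / of_real (ln a))
      = 1 / (fact k * of_real (ln a)) * (exp (p * of_real L) * d ^ l)" .
  have "(\<Prod>j = 1..l + k. of_real (real k * log_ratio a b) + imag_shift (a * b) a k n - of_nat j)
      = (\<Prod>j = 0..<l + k. p + of_nat j)"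
    by (rule prod.reindex_bij_witness[of _ "\<lambda>j. l + k - j" "\<lambda>j. l + k - j"])
       (auto simp: p_def pole_lkn_def algebra_simps of_nat_diff)
  also have "\<dots> = pochhammer p (l + k)" by (simp add: pochhammer_prod)
  finally have 2: "(\<Prod>j = 1..l + k. of_real (real k * log_ratio a b) + imag_shift (a * b) a k n - of_nat j)
      = pochhammer p (l + k)" .
  show ?thesis
    unfolding res_lkn_def 1 2 coef_def p_def[symmetric] d_def[symmetric] L_def[symmetric] power_mult_distrib
    by (simp add: mult_ac)
qed

section \<open>Excluded triples and the residues at nonpositive integers\<close>

text \<open>Residues first arise as sums over this set, which is in bijection with the resonant
  pairs because the imaginary part determines \<open>n\<close>. The restriction to
  \<open>A_set\<close> is introduced afterwards.\<close>

definition all_triples_at :: "complex \<Rightarrow> (nat \<times> nat \<times> int) set" where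
  "all_triples_at p = {(l, k, n). pole l k n = p}"

lemma bij_all_triples_resonant: "bij_betw (\<lambda>(l, k, n). (l, k)) (all_triples_at p) (resonant p)"
  unfolding bij_betw_def
proof
  show "inj_on (\<lambda>(l, k, n). (l, k)) (all_triples_at p)"
    using pole_inj by (fastforce simp: inj_on_def all_triples_at_def)
  show "(\<lambda>(l, k, n). (l, k)) ` all_triples_at p = resonant p"
    by (force simp: all_triples_at_def resonant_iff image_iff)
qed

lemma finite_all_triples_at: "finite (all_triples_at p)"
  using bij_betw_finite[OF bij_all_triples_resonant] finite_resonant by blast

text \<open>One condition replaces the case distinction: the imaginary shift vanishes. For negative
  \<open>a * b\<close> and odd \<open>k\<close> this is impossible by parity, in accordance with
  \<open>A_set\<close> being everything.\<close>

lemma not_in_A_set_iff: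
  "n \<notin> A_set (a * b) a b k \<longleftrightarrow>
     log_ratio a b * real k \<in> \<int>\<^sub>\<le>\<^sub>0 \<and> 2 * n + int (l_index (a * b) k) = 0"
proof -
  have "a * b \<noteq> 0" using a_pos b_nonzero by simp
  then show ?thesis unfolding A_set_def l_index_def by (auto elim!: evenE) presburger
qed

text \<open>Comparing real parts gives \<open>log_ratio a b * k = l + k - m\<close>, so exclusion
  amounts to \<open>l + k \<le> m\<close>. This is exactly the condition for
  \<open>pochhammer (- m) (l + k)\<close> to be nonzero.\<close>

lemma pole_eq_minus_nat:
  assumes "pole l k n = - of_nat m"
  shows "2 * n + int (l_index (a * b) k) = 0" "real l + real k * (1 - log_ratio a b) = real m"
    "n \<notin> A_set (a * b) a b k \<longleftrightarrow> l + k \<le> m"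
proof -
  have "Im (pole l k n) = 0" using assms by simp
  then have "2 * real_of_int n + real (l_index (a * b) k) = 0"
    unfolding Im_pole using lna_pos by simp
  then have "real_of_int (2 * n + int (l_index (a * b) k)) = real_of_int 0" by simp
  then show n: "2 * n + int (l_index (a * b) k) = 0" unfolding of_int_eq_iff .
  have "Re (pole l k n) = - real m" using assms by simp
  then show re: "real l + real k * (1 - log_ratio a b) = real m" unfolding Re_pole by simp
  have "log_ratio a b * real k = of_int (int (l + k) - int m)"
    using re by (simp add: algebra_simps)
  then have "log_ratio a b * real k \<in> \<int>\<^sub>\<le>\<^sub>0 \<longleftrightarrow> l + k \<le> m"
    by (simp only: of_int_in_nonpos_Ints_iff) auto
  then show "n \<notin> A_set (a * b) a b k \<longleftrightarrow> l + k \<le> m"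
    using n not_in_A_set_iff by blast
qed

lemma pole_not_in_A_set:
  assumes "n \<notin> A_set (a * b) a b k"
  obtains m where "pole l k n = - of_nat m"
proof -
  from assms have rk: "log_ratio a b * real k \<in> \<int>\<^sub>\<le>\<^sub>0" and n: "2 * n + int (l_index (a * b) k) = 0"
    unfolding not_in_A_set_iff by auto
  from rk obtain i :: nat where i: "log_ratio a b * real k = - real i"
    by (elim nonpos_Ints_cases') auto
  have n': "2 * real_of_int n + real (l_index (a * b) k) = 0"
    using n by (metis of_int_0 of_int_add of_int_mult of_int_numeral of_int_of_nat_eq)
  have "pole l k n = - of_nat (l + k + i)"
    unfolding complex_eq_iff Re_pole Im_pole n' using i by (simp add: algebra_simps)
  then show ?thesis using that by blast
qed

abbreviation "res \<equiv> res_lkn (a * b) ((a - b)\<^sup>2) a b z"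

lemma res_eq_0:
  assumes "pole l k n = - of_nat m" "n \<in> A_set (a * b) a b k"
  shows "res l k n = 0"
proof -
  have "m < l + k" using pole_eq_minus_nat(3)[OF assms(1)] assms(2) by simp
  then have "pochhammer (- of_nat m :: complex) (l + k) = 0"
    by (simp add: pochhammer_of_nat_eq_0_lemma)
  then show ?thesis by (simp add: coef_at_pole[symmetric] assms(1) coef_def)
qed

lemma d_tilde_eq:
  assumes "k \<ge> 1" "real j = real k * (1 - log_ratio a b)"
  shows "d_tilde ((a - b)\<^sup>2) a b j =
    (- 1) ^ (j + k) / fact j * exp (- real j * ln (a - b)) / ln a * real (j choose k)"
proof -
  have "(THE k::nat. k \<ge> 1 \<and> real j = real k * (1 - log_ratio a b)) = k"
    using assms log_ratio_less_1 by (intro the_equality) auto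
  moreover have "(a - b)\<^sup>2 powr (- real j / 2) = exp (- real j * ln (a - b))"
    using diff_pos by (simp add: powr_def ln_realpow)
  ultimately show ?thesis by (simp add: d_tilde_def Let_def)
qed

lemma exp_neg_nat_mult_ln:
  "exp (- of_nat i * of_real (ln (a - b))) = (1 / of_real (a - b) ^ i :: complex)"
proof -
  have "exp (of_real (ln (a - b))) = complex_of_real (a - b)"
    using diff_pos by (simp add: exp_of_real)
  then show ?thesis by (simp add: exp_minus exp_of_nat_mult inverse_eq_divide)
qed

text \<open>With \<open>j = m - l\<close>, the equation for the real part is the one linking
  \<open>j\<close> and \<open>k\<close> in \<open>B_set\<close>. After writing Pochhammer symbols
  and binomials by factorials, both sides become \<open>(- 1) ^ k\<close> times the same quantity
  \<open>V\<close>.\<close>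

lemma res_eq_d_tilde:
  assumes p: "pole l k n = - of_nat m" and A: "n \<notin> A_set (a * b) a b k" and k: "k \<ge> 1"
  shows "res l k n = of_real (d_tilde ((a - b)\<^sup>2) a b (m - l)) *
           pochhammer (- of_nat m) (m - l) * z ^ (m - (m - l))"
proof -
  define j where "j = m - l"
  define d where "d = complex_of_real (a - b)"
  have lk: "l + k \<le> m" using pole_eq_minus_nat(3)[OF p] A by simp
  have m: "m = l + j" "k \<le> j" using lk by (auto simp: j_def)
  have j: "real j = real k * (1 - log_ratio a b)"
    using pole_eq_minus_nat(2)[OF p] lk by (simp add: j_def of_nat_diff)
  have d: "d \<noteq> 0" using diff_pos by (simp add: d_def)
  note E = exp_neg_nat_mult_ln[folded d_def]
  have dt: "complex_of_real (d_tilde ((a - b)\<^sup>2) a b j) =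
      (- 1) ^ (j + k) / fact j * (1 / d ^ j) / of_real (ln a) * of_nat (j choose k)"
    unfolding d_tilde_eq[OF k j] E[symmetric] by (simp flip: exp_of_real)
  have poch: "pochhammer (- of_nat m :: complex) (l + k) = (- 1) ^ (l + k) * fact m / fact (j - k)"
    "pochhammer (- of_nat m :: complex) j = (- 1) ^ j * fact m / fact l"
    using pochhammer_neg_of_nat[OF lk, where ?'a = complex]
      pochhammer_neg_of_nat[of j m, where ?'a = complex] lk by (simp_all add: j_def)
  have bin: "of_nat (j choose k) = (fact j / (fact k * fact (j - k)) :: complex)"
    using m by (simp add: binomial_fact)
  have zd: "(- z * d) ^ l = (- 1) ^ l * z ^ l * d ^ l"
    unfolding power_mult_distrib power_minus[of z] ..
  have sgn: "(- 1) ^ (l + k) * (- 1) ^ l = ((- 1) ^ k :: complex)"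
    "(- 1) ^ (j + k) * (- 1) ^ j = ((- 1) ^ k :: complex)"
    by (simp_all add: power_add mult.commute mult.left_commute flip: power_mult_distrib)
  have dm: "d ^ m = d ^ l * d ^ j" by (simp add: m power_add)
  have mj: "m - j = l" using m by simp
  define V where "V = fact m * z ^ l / (fact (j - k) * fact l * fact k * d ^ j * of_real (ln a))"
  have "coef l k (- of_nat m) / of_real (ln a) = ((- 1) ^ (l + k) * (- 1) ^ l) * V"
    unfolding coef_def d_def[symmetric] E poch zd dm V_def using d lna_pos by (simp add: mult_ac)
  moreover have "of_real (d_tilde ((a - b)\<^sup>2) a b j) * pochhammer (- of_nat m) j * z ^ (m - j) =
      ((- 1) ^ (j + k) * (- 1) ^ j) * V"
    unfolding dt poch bin mj V_def using d lna_pos by (simp add: mult_ac)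
  ultimately have "coef l k (- of_nat m) / of_real (ln a) =
      of_real (d_tilde ((a - b)\<^sup>2) a b j) * pochhammer (- of_nat m) j * z ^ (m - j)"
    unfolding sgn by simp
  then show ?thesis using coef_at_pole[of l k n] p by (simp add: j_def)
qed

text \<open>The triple \<open>(m, 0, 0)\<close> yields the leading term of \<open>res_int\<close>.
  Those with \<open>k \<ge> 1\<close> are matched with \<open>B_set\<close> through
  \<open>j = m - l\<close>: \<open>j\<close> determines \<open>l\<close>, then \<open>k\<close>
  because \<open>log_ratio a b < 1\<close>, then \<open>n\<close> because the imaginary part
  vanishes.\<close>

lemma sum_res_excluded:
  "(\<Sum>(l, k, n) \<in> {(l, k, n). pole l k n = - of_nat m \<and> n \<notin> A_set (a * b) a b k}. res l k n) =
     res_int (a * b) ((a - b)\<^sup>2) a b z m"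
proof -
  define X where "X = {(l, k, n). pole l k n = - of_nat m \<and> n \<notin> A_set (a * b) a b k \<and> k \<ge> 1}"
  define g where "g = (\<lambda>j. of_real (d_tilde ((a - b)\<^sup>2) a b j) * pochhammer (- of_nat m) j * z ^ (m - j))"
  let ?f = "\<lambda>(l :: nat, k :: nat, n :: int). m - l"
  have pole0: "pole l 0 n = - of_nat m \<longleftrightarrow> l = m \<and> n = 0" for l n
    using lna_pos by (auto simp: complex_eq_iff Re_pole Im_pole l_index_def)
  have A0: "0 \<notin> A_set (a * b) a b 0" unfolding not_in_A_set_iff by (simp add: l_index_def)
  have split: "{(l, k, n). pole l k n = - of_nat m \<and> n \<notin> A_set (a * b) a b k} = insert (m, 0, 0) X"
    using A0 pole0 by (auto simp: X_def) (metis Suc_leI neq0_conv pole0 One_nat_def)+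
  have "X \<subseteq> all_triples_at (- of_nat m)" by (auto simp: X_def all_triples_at_def)
  then have fin: "finite X" using finite_all_triples_at finite_subset by blast
  have XD: "real (m - l) = real k * (1 - log_ratio a b)" "l \<le> m"
    "2 * n + int (l_index (a * b) k) = 0" if "(l, k, n) \<in> X" for l k n
  proof -
    have p: "pole l k n = - of_nat m" and lk: "l + k \<le> m"
      using that pole_eq_minus_nat(3) by (auto simp: X_def)
    then show "real (m - l) = real k * (1 - log_ratio a b)" "l \<le> m"
      using pole_eq_minus_nat(2)[OF p] by (auto simp: of_nat_diff)
    show "2 * n + int (l_index (a * b) k) = 0" by (rule pole_eq_minus_nat(1)[OF p])
  qed
  have inj: "inj_on ?f X"
  proof (rule inj_onI)
    fix x x' assume "x \<in> X" "x' \<in> X" "?f x = ?f x'"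
    moreover obtain l k n l' k' n' where x: "x = (l, k, n)" "x' = (l', k', n')"
      by (metis prod_cases3)
    ultimately have X: "(l, k, n) \<in> X" "(l', k', n') \<in> X" and eq: "m - l = m - l'" by auto
    have "l = l'" using eq XD(2)[OF X(1)] XD(2)[OF X(2)] by simp
    moreover have "k = k'" using XD(1)[OF X(1)] XD(1)[OF X(2)] eq log_ratio_less_1 by simp
    ultimately show "x = x'" unfolding x using XD(3)[OF X(1)] XD(3)[OF X(2)] by simp
  qed
  have img: "?f ` X = {j \<in> B_set (a * b) a b. j \<le> m}"
  proof (intro set_eqI iffI)
    fix j assume "j \<in> ?f ` X"
    then obtain l k n where X: "(l, k, n) \<in> X" and j: "j = m - l" by auto
    have "k \<ge> 1" and A: "n \<notin> A_set (a * b) a b k" using X by (auto simp: X_def)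
    have "even k" if "a * b < 0" using XD(3)[OF X] that by (simp add: l_index_def) presburger
    moreover have "j \<ge> 1"
      using XD(1)[OF X] \<open>k \<ge> 1\<close> log_ratio_less_1 j by (cases j) auto
    ultimately show "j \<in> {j \<in> B_set (a * b) a b. j \<le> m}"
      using \<open>k \<ge> 1\<close> XD(1)[OF X] A j unfolding B_set_def not_in_A_set_iff by auto
  next
    fix j assume "j \<in> {j \<in> B_set (a * b) a b. j \<le> m}"
    then obtain k where k: "k \<ge> 1" "real j = real k * (1 - log_ratio a b)"
      "log_ratio a b * real k \<in> \<int>\<^sub>\<le>\<^sub>0" "a * b < 0 \<longrightarrow> even k" and j: "j \<le> m"
      unfolding B_set_def by auto
    \<comment> \<open>The only \<open>n\<close> giving a real pole. The division is exact:
      \<open>l_index\<close> is 0 for positive \<open>a * b\<close>, and \<open>k\<close> is even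
      otherwise.\<close>
    define n where "n = - int (l_index (a * b) k div 2)"
    have n: "2 * n + int (l_index (a * b) k) = 0"
      using k(4) by (auto simp: n_def l_index_def)
    then have n': "2 * real_of_int n + real (l_index (a * b) k) = 0"
      by (metis of_int_0 of_int_add of_int_mult of_int_numeral of_int_of_nat_eq)
    have "pole (m - j) k n = - of_nat m"
      unfolding complex_eq_iff Re_pole Im_pole n' using k(2) j by (simp add: of_nat_diff)
    then have "(m - j, k, n) \<in> X" using n k by (simp add: X_def not_in_A_set_iff)
    then show "j \<in> ?f ` X" using j by (force simp: image_iff)
  qed
  have "(\<Sum>(l, k, n)\<in>X. res l k n) = (\<Sum>x\<in>X. g (?f x))"
    by (rule sum.cong) (auto simp: X_def g_def res_eq_d_tilde)
  also have "\<dots> = (\<Sum>j\<in>?f ` X. g j)" by (simp add: sum.reindex[OF inj])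
  finally have sumX: "(\<Sum>(l, k, n)\<in>X. res l k n) = (\<Sum>j\<in>{j \<in> B_set (a * b) a b. j \<le> m}. g j)"
    unfolding img .
  have "res m 0 0 = z ^ m / of_real (ln a)"
  proof -
    define d where "d = complex_of_real (a - b)"
    have d: "d \<noteq> 0" using diff_pos by (simp add: d_def)
    have p: "pole m 0 0 = - of_nat m" using pole0 by simp
    have poch: "pochhammer (- of_nat m :: complex) (m + 0) = (- 1) ^ m * fact m"
      using pochhammer_neg_of_nat[of m m, where ?'a = complex] by simp
    have zd: "(- z * d) ^ m = (- 1) ^ m * (z ^ m * d ^ m)"
      unfolding power_mult_distrib power_minus[of z] by (rule mult.assoc)
    have "coef m 0 (- of_nat m) = ((- 1) ^ m * (- 1) ^ m) * z ^ m"
      unfolding coef_def exp_neg_nat_mult_ln d_def[symmetric] poch zd using d by simp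
    then have "coef m 0 (- of_nat m) = z ^ m" by (simp flip: power_mult_distrib)
    then show ?thesis by (simp add: coef_at_pole[symmetric] p)
  qed
  moreover have "(m, 0, 0) \<notin> X" by (simp add: X_def)
  ultimately show ?thesis using fin sumX by (simp add: split res_int_def g_def)
qed

section \<open>Residues and poles of the continuation\<close>

lemma
  shows residue_zeta_cont: "residue zeta_cont p =
      (\<Sum>m | - of_nat m = p. res_int (a * b) ((a - b)\<^sup>2) a b z m) +
      (\<Sum>(l, k, n) \<in> triples_at (a * b) a b p. res l k n)" (is "_ = ?R")
    and is_pole_zeta_cont_iff: "is_pole zeta_cont p \<longleftrightarrow> residue zeta_cont p \<noteq> 0"
    and zorder_zeta_cont: "is_pole zeta_cont p \<Longrightarrow> zorder zeta_cont p = - 1"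
    and meromorphic_zeta_cont: "zeta_cont meromorphic_on {p}"
    and analytic_zeta_cont: "resonant p = {} \<Longrightarrow> zeta_cont analytic_on {p}"
proof -
  obtain g \<psi> where g: "g analytic_on {p}" "g p = 1 / of_real (ln a)" and psi: "\<psi> analytic_on {p}"
    and eq: "\<forall>\<^sub>F s in nhds p. zeta_cont s =
      (\<Sum>(l, k)\<in>resonant p. coef l k s * geom_ratio l k s ^ N) * g s / (s - p) + \<psi> s"
    by (rule zeta_cont_local_form)
  define \<phi> where "\<phi> = (\<lambda>s. (\<Sum>(l, k)\<in>resonant p. coef l k s * geom_ratio l k s ^ N) * g s)"
  have eq': "\<forall>\<^sub>F s in at p. zeta_cont s = \<phi> s / (s - p) + \<psi> s"
    using eq unfolding eventually_at_filter \<phi>_def by eventually_elim auto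
  have "(\<lambda>s. \<Sum>(l, k)\<in>resonant p. coef l k s * geom_ratio l k s ^ N) holomorphic_on UNIV"
    unfolding case_prod_unfold by (intro holomorphic_intros)
  then have "(\<lambda>s. \<Sum>(l, k)\<in>resonant p. coef l k s * geom_ratio l k s ^ N) analytic_on {p}"
    using analytic_at by blast
  then have phi: "\<phi> analytic_on {p}" unfolding \<phi>_def using g(1) by (rule analytic_on_mult)
  note form = residue_simple_pole_form[OF phi psi eq'] is_pole_simple_pole_form_iff[OF phi psi eq']
  show "is_pole zeta_cont p \<longleftrightarrow> residue zeta_cont p \<noteq> 0" using form by simp
  show "zorder zeta_cont p = - 1" if "is_pole zeta_cont p" by (rule zorder_simple_pole_form[OF phi psi eq' that])
  show "zeta_cont meromorphic_on {p}" by (rule meromorphic_simple_pole_form[OF phi psi eq'])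
  show "zeta_cont analytic_on {p}" if "resonant p = {}"
    using psi eq that by (subst analytic_at_cong[where g = \<psi> and y = p]) auto
  \<comment> \<open>The powers of \<open>geom_ratio\<close> disappear because the ratio is 1 at
    \<open>p\<close>, and \<open>g p\<close> supplies \<open>1 / ln a\<close>.\<close>
  have "residue zeta_cont p = (\<Sum>(l, k)\<in>resonant p. coef l k p / of_real (ln a))"
    unfolding form \<phi>_def g(2) sum_distrib_right by (rule sum.cong) (auto simp: resonant_def)
  also have "\<dots> = (\<Sum>x\<in>all_triples_at p.
      case (case x of (l, k, n) \<Rightarrow> (l, k)) of (l, k) \<Rightarrow> coef l k p / of_real (ln a))"
    by (rule sum.reindex_bij_betw[OF bij_all_triples_resonant, symmetric])
  also have "\<dots> = (\<Sum>(l, k, n)\<in>all_triples_at p. res l k n)"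
    by (rule sum.cong) (auto simp: all_triples_at_def coef_at_pole)
  also have "\<dots> = (\<Sum>(l, k, n)\<in>all_triples_at p - triples_at (a * b) a b p. res l k n) +
      (\<Sum>(l, k, n)\<in>triples_at (a * b) a b p. res l k n)"
    by (rule sum.subset_diff) (auto simp: all_triples_at_def triples_at_def finite_all_triples_at[unfolded all_triples_at_def])
  also have "(\<Sum>(l, k, n)\<in>all_triples_at p - triples_at (a * b) a b p. res l k n) =
      (\<Sum>m | - of_nat m = p. res_int (a * b) ((a - b)\<^sup>2) a b z m)"
  proof (cases "\<exists>m. p = - of_nat m")
    case True
    then obtain m where m: "p = - of_nat m" ..
    have "{m. - of_nat m = p} = {m}" by (auto simp: m)
    moreover have "all_triples_at p - triples_at (a * b) a b p =
        {(l, k, n). pole l k n = - of_nat m \<and> n \<notin> A_set (a * b) a b k}"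
      by (auto simp: all_triples_at_def triples_at_def m)
    ultimately show ?thesis by (simp add: sum_res_excluded)
  next
    case False
    have "n \<in> A_set (a * b) a b k" if "pole l k n = p" for l k n
      using pole_not_in_A_set[of n k l] False that by metis
    then have "all_triples_at p - triples_at (a * b) a b p = {}"
      by (auto simp: all_triples_at_def triples_at_def)
    moreover have "{m. - of_nat m = p} = {}" using False by auto
    ultimately show ?thesis by (simp only: sum.empty)
  qed
  finally show "residue zeta_cont p = ?R" .
qed

lemma residue_zeta_cont_minus_nat:
  "residue zeta_cont (- of_nat m) = res_int (a * b) ((a - b)\<^sup>2) a b z m"
proof -
  have "(\<Sum>(l, k, n) \<in> triples_at (a * b) a b (- of_nat m). res l k n) = 0"
    by (rule sum.neutral) (auto simp: triples_at_def res_eq_0)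
  moreover have "{m'. - of_nat m' = (- of_nat m :: complex)} = {m}" by auto
  ultimately show ?thesis by (simp add: residue_zeta_cont)
qed

lemma pole_zeta_cont_cases:
  assumes "is_pole zeta_cont p"
  shows "(\<exists>l. p = - of_nat l) \<or> (\<exists>l k n. n \<in> A_set (a * b) a b k \<and> p = pole l k n)"
proof (rule ccontr)
  assume *: "\<not> ?thesis"
  then have "triples_at (a * b) a b p = {}" "{m. - of_nat m = p} = {}"
    by (auto simp: triples_at_def)
  then have "residue zeta_cont p = 0" by (simp add: residue_zeta_cont)
  with assms show False by (simp add: is_pole_zeta_cont_iff)
qed

text \<open>All zeros of the denominators have real part at most 0, so \<open>zeta_cont\<close> is
  analytic here and \<open>remove_sings\<close> leaves its value unchanged.\<close>

lemma remove_sings_zeta_cont_eq_zeta: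
  assumes "Re s > 0"
  shows "remove_sings zeta_cont s = zeta_U a b s z"
proof -
  have "resonant s = {}"
  proof safe
    fix l k assume "(l, k) \<in> resonant s"
    then obtain n where "pole l k n = s" by (auto simp: resonant_iff)
    then have "Re s = - real l - real k * (1 - log_ratio a b)" using Re_pole by metis
    moreover have "real k * (1 - log_ratio a b) \<ge> 0" using log_ratio_less_1 by simp
    ultimately show "(l, k) \<in> {}" using assms by linarith
  qed
  then have "remove_sings zeta_cont s = zeta_cont s"
    by (intro remove_sings_at_analytic analytic_zeta_cont)
  then show ?thesis using zeta_eq_zeta_cont(2)[OF assms] by simp
qed

end

section \<open>Choice of \<open>N\<close>, roots of the quadratic, and conclusion\<close>

lemma lucas_zeta_exponent_exists:
  assumes "a > 1" "\<bar>b\<bar> < a"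
  obtains N :: nat where "N \<ge> 1" "norm z * (a - b) * (1 / a) ^ N + (\<bar>b\<bar> / a) ^ N < 1"
proof -
  have "(\<lambda>n. norm z * (a - b) * (1 / a) ^ n + (\<bar>b\<bar> / a) ^ n) \<longlonglongrightarrow> norm z * (a - b) * 0 + 0"
    using assms by (intro tendsto_add tendsto_mult tendsto_const LIMSEQ_power_zero) auto
  then have "\<forall>\<^sub>F n in sequentially. norm z * (a - b) * (1 / a) ^ n + (\<bar>b\<bar> / a) ^ n < 1"
    by (rule order_tendstoD) simp
  then have "\<forall>\<^sub>F n in sequentially. n \<ge> 1 \<and> norm z * (a - b) * (1 / a) ^ n + (\<bar>b\<bar> / a) ^ n < 1"
    using eventually_ge_at_top[of 1] by eventually_elim auto
  then show ?thesis using that eventually_happens'[OF sequentially_bot] by blast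
qed

text \<open>From \<open>Q \<le> P - 1\<close> the discriminant is at least
  \<open>(P - 2) ^ 2\<close>, strictly so if \<open>P \<le> 2\<close>; in either case
  \<open>2 - P < r\<close> for its root \<open>r\<close>, which says that
  \<open>(P + r) / 2 > 1\<close>. Equality is harmless for \<open>P > 2\<close>, where
  \<open>2 - P\<close> is negative. The bound on \<open>\<bar>b\<bar>\<close> follows from
  \<open>r > 0\<close> and \<open>P > 0\<close>.\<close>

lemma quadratic_roots_bounds:
  fixes P Q a b :: real
  assumes "P > 0" "Q \<noteq> 0" and Q1: "P > 2 \<longrightarrow> Q \<le> P - 1" and Q2: "P \<le> 2 \<longrightarrow> Q < P - 1"
    and roots: "{x :: real. x ^ 2 - P * x + Q = 0} = {a, b}" and "a \<ge> b"
  shows "a > 1" "\<bar>b\<bar> < a" "b \<noteq> 0" "Q = a * b" "P ^ 2 - 4 * Q = (a - b) ^ 2"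
proof -
  define r where "r = sqrt (P ^ 2 - 4 * Q)"
  have "P ^ 2 - 4 * Q > 0 \<and> (P \<le> 2 \<longrightarrow> (2 - P) ^ 2 < P ^ 2 - 4 * Q)"
  proof (cases "P > 2")
    case True
    then have "0 < (P - 2) ^ 2" by simp
    then show ?thesis using Q1 True by (simp add: power2_eq_square algebra_simps)
  next
    case False
    then have "(2 - P) ^ 2 < P ^ 2 - 4 * Q" using Q2 by (simp add: power2_eq_square algebra_simps)
    then show ?thesis using zero_le_power2[of "2 - P"] by linarith
  qed
  then have D: "P ^ 2 - 4 * Q > 0" and D2: "P \<le> 2 \<Longrightarrow> (2 - P) ^ 2 < P ^ 2 - 4 * Q" by auto
  have r: "r > 0" "r ^ 2 = P ^ 2 - 4 * Q" using D by (simp_all add: r_def)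
  have "P \<le> 2 \<Longrightarrow> 2 - P < r" unfolding r_def using D2 by (rule real_less_rsqrt)
  then have r2: "2 - P < r" using r(1) by linarith
  have "(P + r) / 2 \<in> {x. x ^ 2 - P * x + Q = 0}" "(P - r) / 2 \<in> {x. x ^ 2 - P * x + Q = 0}"
    using r(2) by (auto simp: power2_eq_square field_simps)
  then have "(P + r) / 2 \<in> {a, b}" "(P - r) / 2 \<in> {a, b}" unfolding roots .
  then have ab: "a = (P + r) / 2" "b = (P - r) / 2" using r(1) \<open>a \<ge> b\<close> by auto
  show "a > 1" using r2 ab by simp
  show "\<bar>b\<bar> < a" using r(1) \<open>P > 0\<close> ab by simp
  have "a * b = (P ^ 2 - r ^ 2) / 4" unfolding ab by (simp add: power2_eq_square field_simps)
  then show Q: "Q = a * b" using r(2) by simp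
  then show "b \<noteq> 0" using \<open>Q \<noteq> 0\<close> by auto
  have "a - b = r" unfolding ab by (simp add: field_simps)
  then show "P ^ 2 - 4 * Q = (a - b) ^ 2" using r(2) by simp
qed

theorem theorem4p1:
  fixes P Q a b D :: real and z :: complex
  assumes "P > 0" and "Q \<noteq> 0"
    and "P > 2 \<Longrightarrow> Q \<le> P - 1"
    and "P \<le> 2 \<Longrightarrow> Q < P - 1"
    and "{x :: real. x ^ 2 - P * x + Q = 0} = {a, b}" and "a \<ge> b"
    and "D = P ^ 2 - 4 * Q"
    and "z \<notin> \<real>\<^sub>\<le>\<^sub>0"
  shows "\<exists>F. F nicely_meromorphic_on UNIV \<and>
    (\<forall>s. Re s > 0 \<longrightarrow>
       summable (\<lambda>n. (z + of_real (lucas_U a b n)) powr (- s)) \<and> F s = zeta_U a b s z) \<and>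
    (\<forall>p. is_pole F p \<longrightarrow>
       (\<exists>l. p = - of_nat l) \<or>
       (\<exists>l k n. n \<in> A_set Q a b k \<and> p = pole_lkn Q a b l k n)) \<and>
    (\<forall>p. is_pole F p \<longrightarrow> zorder F p = - 1) \<and>
    (\<forall>p. residue F p \<noteq> 0 \<longrightarrow> is_pole F p) \<and>
    (\<forall>l. residue F (- of_nat l) = res_int Q D a b z l) \<and>
    (\<forall>l k n. n \<in> A_set Q a b k \<longrightarrow>
       residue F (pole_lkn Q a b l k n) =
         (\<Sum>m | - of_nat m = pole_lkn Q a b l k n. res_int Q D a b z m) +
         (\<Sum>(l', k', n') \<in> triples_at Q a b (pole_lkn Q a b l k n).
            res_lkn Q D a b z l' k' n'))"
proof -
  have "P > 2 \<longrightarrow> Q \<le> P - 1" "P \<le> 2 \<longrightarrow> Q < P - 1" using assms(3,4) by simp_all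
  note ab = quadratic_roots_bounds[OF assms(1,2) this assms(5,6)]
  obtain N :: nat where N: "N \<ge> 1" "norm z * (a - b) * (1 / a) ^ N + (\<bar>b\<bar> / a) ^ N < 1"
    using lucas_zeta_exponent_exists[OF ab(1,2)] by blast
  interpret lucas_zeta a b z N
    using ab assms(8) N by unfold_locales auto
  have iso: "isolated_singularity_at zeta_cont p" for p
    by (rule meromorphic_on_isolated_singularity[OF meromorphic_zeta_cont])
  have "zeta_cont meromorphic_on UNIV"
    using meromorphic_zeta_cont unfolding meromorphic_on_altdef by blast
  \<comment> \<open>Only values at isolated singularities change, so poles, orders and residues
    carry over from \<open>zeta_cont\<close>.\<close>
  then have "remove_sings zeta_cont nicely_meromorphic_on UNIV"
    by (rule remove_sings_nicely_meromorphic)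
  moreover have "D = (a - b) ^ 2" using assms(7) ab(5) by simp
  moreover note \<open>Q = a * b\<close>
  ultimately show ?thesis
    using zeta_eq_zeta_cont(1) remove_sings_zeta_cont_eq_zeta pole_zeta_cont_cases zorder_zeta_cont
      is_pole_zeta_cont_iff residue_zeta_cont_minus_nat residue_zeta_cont
    by (intro exI[of _ "remove_sings zeta_cont"]) (simp add: iso residue_remove_sings)
qed

end
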